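(* Let $X,U$ be nonempty sets, $f:X\times U\to X$, $\sigma:X\to\mathbb{R}_{\ge 0}$ and $\rho:U\to\mathbb{R}_{\ge 0}$ arbitrary functions, and consider the system $x_+=f(x,u)$. Let $\mathbb{X}\subseteq X$, $\beta\in\mathcal{KL}$, $\eta:\mathbb{R}_{\ge 0}\to\mathbb{R}_{\ge 0}$ some function, and $\gamma\in\mathcal{K}_\infty$, such that for all $x\in\mathbb{X}$ there exists $u_x\in U^\infty$ with (i) $\sigma(\phi(n;x,u_x))\le\beta(\sigma(x),n)$ for all $n\ge 0$, and (ii) $\sum_{n=0}^{N-1}\eta(\rho(u_x(n)))\le\gamma(\sigma(x))$ for all $N\ge 1$. Then there exist $q\in\mathcal{K}_\infty$, $r:\mathbb{R}_{\ge 0}\to\mathbb{R}_{\ge 0}$ and $\bar\alpha\in\mathcal{K}_\infty$ such that the system is uniformly cost controllable on $\mathbb{X}$ with respect to $\ell(x,u)=q(\sigma(x))+r(\rho(u))$ and total cost bound $\bar\alpha$. Additionally, (1) if $\eta$ is positive definite, then $r$ can be chosen positive definite; (2) if $\eta\in\mathcal{K}_\infty$, then $r$ can be chosen in $\mathcal{K}_\infty$. More explicitly: for any $\theta\in(0,1)$ and $\gamma_1,\gamma_2\in\mathcal{K}_\infty$ with $\beta(s,n)\le\gamma_2(\theta^n\gamma_1(s))$ for all $s\ge 0$, $n\in\mathbb{N}$, for all $q\in\mathcal{K}_\infty$ with $q\le C_q\cdot\gamma_2^{-1}$ for some $C_q>0$, and for all $r:\mathbb{R}_{\ge 0}\to\mathbb{R}_{\ge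 0}$ with $r\le C_r\cdot\eta$ for some $C_r>0$, the system is uniformly cost controllable on $\mathbb{X}$ with respect to $\ell(x,u)=q(\sigma(x))+r(\rho(u))$ with total cost bound $\bar\alpha=\frac{C_q}{1-\theta}\gamma_1+C_r\cdot\gamma$.
   Context: $\mathbb{N}=\{0,1,2,\dots\}$ and $U^\infty=U^{\mathbb{N}}$ is the set of infinite input sequences. Trajectories: $\phi(0;x,u)=x$, $\phi(n+1;x,u)=f(\phi(n;x,u),u(n))$ for $n\ge 0$. Comparison functions: $\mathcal{K}$ is the set of continuous strictly increasing $\alpha:\mathbb{R}_{\ge 0}\to\mathbb{R}_{\ge 0}$ with $\alpha(0)=0$; $\mathcal{K}_\infty$ is the set of $\alpha\in\mathcal{K}$ with $\lim_{s\to\infty}\alpha(s)=\infty$ (these are invertible with inverse in $\mathcal{K}_\infty$); $\mathcal{KL}$ is the set of continuous $\beta:\mathbb{R}_{\ge 0}\times\mathbb{R}_{\ge 0}\to\mathbb{R}_{\ge 0}$ such that $\beta(\cdot,t)\in\mathcal{K}_\infty$ for all $t\ge 0$, and for all $s>0$ the function $\beta(s,\cdot)$ is strictly decreasing with $\lim_{t\to\infty}\beta(s,t)=0$. Operations and inequalities between such functions are pointwise. A function $r:\mathbb{R}_{\ge 0}\to\mathbb{R}_{\ge 0}$ is positive definite if $r(0)=0$ and $r(s)>0$ for $s>0$. For a stage cost $\ell:X\times U\to\mathbb{R}_{\ge 0}$, set $J_\infty(x,u\mid\ell)=\sum_{n=0}^{\infty}\ell(\phi(n;x,u),u(n))\in[0,\infty]$.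 The system is uniformly cost controllable on $\mathbb{X}$ with respect to $\ell$ and total cost bound $\bar\alpha\in\mathcal{K}_\infty$ if for all $x\in\mathbb{X}$ there exists $u_x\in U^\infty$ with $J_\infty(x,u_x\mid\ell)\le\bar\alpha(\sigma(x))$. *)

theory Defs
  imports "HOL-Library.Extended_Nonnegative_Real" "HOL-Library.FuncSet"
begin

text \<open>
  A function on the nonnegative reals is represented by a function of type
  \<open>real \<Rightarrow> real\<close> (or \<open>real \<Rightarrow> real \<Rightarrow> real\<close>); its values at negative arguments are
  irrelevant, so every condition below is relativised to \<open>{0..}\<close>.
  The state space and the input space are types, hence nonempty.
\<close>

definition class_K :: "(real \<Rightarrow> real) set" where
  "class_K = {\<alpha> \<in> {0..} \<rightarrow> {0..}.
     continuous_on {0..} \<alpha> \<and> strict_mono_on {0..} \<alpha> \<and> \<alpha> 0 = 0}"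

definition class_K_inf :: "(real \<Rightarrow> real) set" where
  "class_K_inf = {\<alpha> \<in> class_K. filterlim \<alpha> at_top at_top}"

definition class_KL :: "(real \<Rightarrow> real \<Rightarrow> real) set" where
  "class_KL = {\<beta>.
     continuous_on ({0..} \<times> {0..}) (\<lambda>(s, t). \<beta> s t) \<and>
     (\<forall>t\<ge>0. (\<lambda>s. \<beta> s t) \<in> class_K_inf) \<and>
     (\<forall>s>0. strict_antimono_on {0..} (\<beta> s) \<and> (\<beta> s \<longlongrightarrow> 0) at_top)}"

definition pos_def :: "(real \<Rightarrow> real) \<Rightarrow> bool" where
  "pos_def r \<longleftrightarrow> r \<in> {0..} \<rightarrow> {0..} \<and> r 0 = 0 \<and> (\<forall>s>0. r s > 0)"

primrec trajectory :: "('x \<Rightarrow> 'u \<Rightarrow> 'x) \<Rightarrow> nat \<Rightarrow> 'x \<Rightarrow> (nat \<Rightarrow> 'u) \<Rightarrow> 'x" where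
  "trajectory f 0 x u = x"
| "trajectory f (Suc n) x u = f (trajectory f n x u) (u n)"

text \<open>
  The coercion \<^const>\<open>ennreal\<close> maps negative numbers to 0; the total cost is only meaningful for
  nonnegative stage costs.
\<close>

definition total_cost ::
    "('x \<Rightarrow> 'u \<Rightarrow> 'x) \<Rightarrow> ('x \<Rightarrow> 'u \<Rightarrow> real) \<Rightarrow> 'x \<Rightarrow> (nat \<Rightarrow> 'u) \<Rightarrow> ennreal" where
  "total_cost f l x u = (\<Sum>n. ennreal (l (trajectory f n x u) (u n)))"

definition uniformly_cost_controllable ::
    "('x \<Rightarrow> 'u \<Rightarrow> 'x) \<Rightarrow> ('x \<Rightarrow> real) \<Rightarrow> 'x set \<Rightarrow> ('x \<Rightarrow> 'u \<Rightarrow> real) \<Rightarrow> (real \<Rightarrow> real) \<Rightarrow> bool" where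
  "uniformly_cost_controllable f \<sigma> S l \<alpha> \<longleftrightarrow>
     (\<forall>x u. 0 \<le> l x u) \<and> \<alpha> \<in> class_K_inf \<and>
     (\<forall>x\<in>S. \<exists>u. total_cost f l x u \<le> ennreal (\<alpha> (\<sigma> x)))"

end

theory Submission
  imports Defs "HOL-Analysis.Uniform_Limit"
begin

text \<open>
  The explicit bound comes from comparing the state cost with a geometric series: along a
  controlled trajectory \<open>q (\<sigma> (\<phi> n)) \<le> C\<^sub>q * \<gamma>\<^sub>2\<^sup>-\<^sup>1 (\<gamma>\<^sub>2 (\<theta> ^ n * \<gamma>\<^sub>1 (\<sigma> x)))\<close>.

  The existence claims would follow from this together with Sontag's \<open>KL\<close>-lemma, which supplies
  \<open>\<theta>\<close>, \<open>\<gamma>\<^sub>1\<close> and \<open>\<gamma>\<^sub>2\<close>. They need less, however: a single \<open>q\<close> of class \<open>K\<^sub>\<infinity>\<close> for which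
  \<open>s \<mapsto> \<Sum>n. q (\<beta> s n)\<close> is finite everywhere and again of class \<open>K\<^sub>\<infinity>\<close>
  (lemma \<open>class_KL_summable_gain\<close>). Adding \<open>\<gamma>\<close> to this sum gives a total cost bound for \<open>r = \<eta>\<close>,
  and this \<open>r\<close> inherits positive definiteness or membership in \<open>K\<^sub>\<infinity>\<close> from \<open>\<eta>\<close>.

  To construct \<open>q\<close>, choose \<open>N k\<close> such that \<open>\<beta> k n < 1 / (k + 1)\<close> for all \<open>n \<ge> N k\<close>, and let
  \<open>q t = (\<Sum>k. (1/2) ^ k / (N k + 1) * max 0 (t - 1 / (k + 1)))\<close>.
  For \<open>s \<le> M\<close> and \<open>n \<ge> N M\<close>, the \<open>k\<close>-th term of \<open>q (\<beta> s n)\<close> vanishes if \<open>k \<le> M\<close>, and if \<open>k > M\<close>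
  it is nonzero for at most \<open>N k\<close> values of \<open>n\<close>. Hence that term contributes at most
  \<open>(1/2) ^ k * \<beta> M 0\<close> to the sum over all \<open>n \<ge> N M\<close>, and the total is finite. Both \<open>q\<close> and the sum
  are of class \<open>K\<^sub>\<infinity>\<close> because, for increasing summands, pointwise convergence at \<open>M\<close> entails uniform
  convergence on \<open>{0..M}\<close> (lemma \<open>class_K_inf_suminf\<close>).
\<close>

section \<open>Functions of class \<open>K\<^sub>\<infinity>\<close>\<close>

lemma class_K_infD:
  assumes "\<alpha> \<in> class_K_inf"
  shows "\<And>s. s \<ge> 0 \<Longrightarrow> \<alpha> s \<ge> 0" and "continuous_on {0..} \<alpha>" and "strict_mono_on {0..} \<alpha>"
    and "\<alpha> 0 = 0" and "filterlim \<alpha> at_top at_top" and "mono_on {0..} \<alpha>"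
  using assms unfolding class_K_inf_def class_K_def by (auto intro: strict_mono_on_imp_mono_on)

lemma class_K_infI:
  assumes "continuous_on {0..} \<alpha>" and sm: "strict_mono_on {0..} \<alpha>"
    and 0: "\<alpha> 0 = 0" and "filterlim \<alpha> at_top at_top"
  shows "\<alpha> \<in> class_K_inf"
proof -
  have "\<alpha> s \<ge> 0" if "s \<ge> 0" for s
    using mono_onD[OF strict_mono_on_imp_mono_on[OF sm], of 0 s] that 0 by simp
  then show ?thesis
    using assms unfolding class_K_inf_def class_K_def by auto
qed

lemma class_K_inf_add:
  assumes "\<alpha> \<in> class_K_inf" and "\<alpha>' \<in> class_K_inf"
  shows "(\<lambda>s. \<alpha> s + \<alpha>' s) \<in> class_K_inf"
proof (rule class_K_infI)
  show "strict_mono_on {0..} (\<lambda>s. \<alpha> s + \<alpha>' s)"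
    using class_K_infD(3)[OF assms(1)] class_K_infD(3)[OF assms(2)]
    by (auto simp: strict_mono_on_def intro!: add_strict_mono)
  show "filterlim (\<lambda>s. \<alpha> s + \<alpha>' s) at_top at_top"
    using assms by (intro filterlim_at_top_add_at_top class_K_infD)
qed (auto intro!: continuous_intros simp: class_K_infD(2,4)[OF assms(1)] class_K_infD(2,4)[OF assms(2)])

lemma class_K_inf_cmult:
  assumes "\<alpha> \<in> class_K_inf" and "c > 0"
  shows "(\<lambda>s. c * \<alpha> s) \<in> class_K_inf"
proof (rule class_K_infI)
  show "strict_mono_on {0..} (\<lambda>s. c * \<alpha> s)"
    using class_K_infD(3)[OF assms(1)] \<open>c > 0\<close> by (auto simp: strict_mono_on_def)
  show "filterlim (\<lambda>s. c * \<alpha> s) at_top at_top"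
    using assms by (intro filterlim_tendsto_pos_mult_at_top[OF tendsto_const] class_K_infD)
qed (auto intro!: continuous_intros simp: class_K_infD(2,4)[OF assms(1)])

lemma class_K_inf_image:
  assumes "\<alpha> \<in> class_K_inf"
  shows "\<alpha> ` {0..} = {0..}"
proof (rule antisym)
  show "\<alpha> ` {0..} \<subseteq> {0..}"
    using class_K_infD(1)[OF assms] by auto
  show "{0..} \<subseteq> \<alpha> ` {0..}"
  proof
    fix y :: real assume "y \<in> {0..}"
    moreover have "eventually (\<lambda>b. y \<le> \<alpha> b \<and> 0 \<le> b) at_top"
      using class_K_infD(5)[OF assms] eventually_ge_at_top[of "0::real"]
      by (auto simp: filterlim_at_top eventually_conj_iff)
    then obtain b where "y \<le> \<alpha> b" "0 \<le> b"
      using eventually_happens'[OF trivial_limit_at_top_linorder] by blast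
    moreover have "continuous_on {0..b} \<alpha>"
      by (rule continuous_on_subset[OF class_K_infD(2)[OF assms]]) auto
    ultimately obtain x where "0 \<le> x" "\<alpha> x = y"
      using IVT'[of \<alpha> 0 y b] class_K_infD(4)[OF assms] by auto
    then show "y \<in> \<alpha> ` {0..}" by auto
  qed
qed

lemma class_K_inf_inv_le:
  assumes "\<alpha> \<in> class_K_inf" and "0 \<le> s" and "0 \<le> t" and "s \<le> \<alpha> t"
  shows "inv_into {0..} \<alpha> s \<le> t"
proof -
  have s: "s \<in> \<alpha> ` {0..}"
    using class_K_inf_image[OF assms(1)] \<open>0 \<le> s\<close> by simp
  have "\<alpha> (inv_into {0..} \<alpha> s) \<le> \<alpha> t"
    using f_inv_into_f[OF s] \<open>s \<le> \<alpha> t\<close> by simp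
  then show ?thesis
    using strict_mono_on_less_eq[OF class_K_infD(3)[OF assms(1)]] inv_into_into[OF s] \<open>0 \<le> t\<close>
    by blast
qed

text \<open>
  Monotonicity makes the value at \<open>M\<close> a Weierstrass majorant on \<open>{0..M}\<close>, so that pointwise
  summability is enough for continuity of the sum. Only one of the summands, here the one with
  index 0, has to be unbounded.
\<close>

lemma class_K_inf_suminf:
  fixes g :: "nat \<Rightarrow> real \<Rightarrow> real"
  assumes cont: "\<And>k. continuous_on {0..} (g k)"
    and mono: "\<And>k. mono_on {0..} (g k)"
    and zero: "\<And>k. g k 0 = 0"
    and sums: "\<And>s. s \<ge> 0 \<Longrightarrow> summable (\<lambda>k. g k s)"
    and strict: "\<And>s t. 0 \<le> s \<Longrightarrow> s < t \<Longrightarrow> \<exists>k. g k s < g k t"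
    and unbounded: "filterlim (g 0) at_top at_top"
  shows "(\<lambda>s. \<Sum>k. g k s) \<in> class_K_inf"
proof (rule class_K_infI)
  have le: "g k s \<le> g k t" if "0 \<le> s" "s \<le> t" for k s t
    using mono_onD[OF mono] that by auto
  have nonneg: "0 \<le> g k s" if "0 \<le> s" for k s
    using le[of 0 s k] that zero by simp
  have cont_Icc: "continuous_on {0..M} (\<lambda>s. \<Sum>k. g k s)" if "M \<ge> 0" for M
  proof (rule uniform_limit_theorem)
    show "uniform_limit {0..M} (\<lambda>n s. \<Sum>k<n. g k s) (\<lambda>s. \<Sum>k. g k s) sequentially"
      using sums[OF that] by (rule Weierstrass_m_test[rotated]) (auto simp: nonneg le)
    show "\<forall>\<^sub>F n in sequentially. continuous_on {0..M} (\<lambda>s. \<Sum>k<n. g k s)"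
      by (intro always_eventually allI continuous_intros continuous_on_subset[OF cont]) auto
  qed simp
  show "continuous_on {0..} (\<lambda>s. \<Sum>k. g k s)"
    unfolding continuous_on_def
  proof
    fix s :: real assume "s \<in> {0..}"
    have "at s within {0..} = at s within {0..s + 1}"
      by (rule at_within_nhd[of s "{..<s + 1}"]) auto
    then show "((\<lambda>s. \<Sum>k. g k s) \<longlongrightarrow> (\<Sum>k. g k s)) (at s within {0..})"
      using cont_Icc[of "s + 1"] \<open>s \<in> {0..}\<close> by (auto simp: continuous_on_def)
  qed
  show "strict_mono_on {0..} (\<lambda>s. \<Sum>k. g k s)"
  proof (rule strict_mono_onI)
    fix s t :: real assume st: "s \<in> {0..}" "t \<in> {0..}" "s < t"
    obtain k where k: "g k s < g k t"
      using strict st by auto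
    have "0 < (\<Sum>k. g k t - g k s)"
      using st k by (intro suminf_pos2[of _ k] summable_diff sums) (auto simp: le)
    also have "\<dots> = (\<Sum>k. g k t) - (\<Sum>k. g k s)"
      using st by (intro suminf_diff[symmetric] sums) auto
    finally show "(\<Sum>k. g k s) < (\<Sum>k. g k t)" by simp
  qed
  have "\<forall>\<^sub>F s in at_top. g 0 s \<le> (\<Sum>k. g k s)"
    using eventually_ge_at_top[of "0::real"]
  proof eventually_elim
    case (elim s)
    then show ?case
      using sum_le_suminf[OF sums[OF elim], of "{0}"] nonneg by simp
  qed
  then show "filterlim (\<lambda>s. \<Sum>k. g k s) at_top at_top"
    by (rule filterlim_at_top_mono[OF unbounded])
qed (simp add: zero)

section \<open>A summable gain for a \<open>KL\<close> function\<close>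

text \<open>
  A weighted series of hinge functions: the \<open>k\<close>-th one vanishes up to \<open>1 / (k + 1)\<close> and then grows
  linearly. The number \<open>N k\<close> stands for the time after which a given sequence stays below
  \<open>1 / (k + 1)\<close>. The weight \<open>1 / (N k + 1)\<close> compensates for the at most \<open>N k\<close> earlier values, and the
  factor \<open>(1/2) ^ k\<close> makes the series converge.
\<close>

definition hinge_term :: "(nat \<Rightarrow> nat) \<Rightarrow> nat \<Rightarrow> real \<Rightarrow> real" where
  "hinge_term N k t = (1/2) ^ k / (real (N k) + 1) * max 0 (t - 1 / (real k + 1))"

definition hinge_gain :: "(nat \<Rightarrow> nat) \<Rightarrow> real \<Rightarrow> real" where
  "hinge_gain N t = (\<Sum>k. hinge_term N k t)"

lemma hinge_term_nonneg: "0 \<le> hinge_term N k t"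
  by (simp add: hinge_term_def)

lemma hinge_term_eq_0: "t \<le> 1 / (real k + 1) \<Longrightarrow> hinge_term N k t = 0"
  by (simp add: hinge_term_def)

lemma hinge_term_le:
  assumes "0 \<le> t"
  shows "hinge_term N k t \<le> (1/2) ^ k / (real (N k) + 1) * t"
  unfolding hinge_term_def using assms by (intro mult_left_mono) auto

lemma summable_hinge_term:
  assumes "0 \<le> t"
  shows "summable (\<lambda>k. hinge_term N k t)"
proof (rule summable_comparison_test')
  show "summable (\<lambda>k. (1/2) ^ k * t)"
    by (intro summable_mult2 summable_geometric) simp
  fix k :: nat
  have "(1/2) ^ k / (real (N k) + 1) * t \<le> (1/2) ^ k * t"
    using assms by (intro mult_right_mono) (auto simp: divide_le_eq)
  then show "norm (hinge_term N k t) \<le> (1/2) ^ k * t"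
    using hinge_term_le[OF assms, of N k] by (simp add: hinge_term_nonneg)
qed

lemma hinge_gain_class_K_inf: "hinge_gain N \<in> class_K_inf"
proof -
  have "(\<lambda>t. \<Sum>k. hinge_term N k t) \<in> class_K_inf"
  proof (rule class_K_inf_suminf)
    show "continuous_on {0..} (hinge_term N k)" for k
      unfolding hinge_term_def by (intro continuous_intros)
    show "mono_on {0..} (hinge_term N k)" for k
      unfolding hinge_term_def by (intro mono_onI mult_left_mono) auto
    show "hinge_term N k 0 = 0" for k
      by (simp add: hinge_term_eq_0)
    show "\<exists>k. hinge_term N k s < hinge_term N k t" if "0 \<le> s" "s < t" for s t
    proof -
      obtain k where "1 / (real k + 1) < t"
        using reals_Archimedean[of t] \<open>0 \<le> s\<close> \<open>s < t\<close> by (auto simp: inverse_eq_divide add.commute)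
      then have "hinge_term N k s < hinge_term N k t"
        unfolding hinge_term_def using \<open>s < t\<close> by (intro mult_strict_left_mono) auto
      then show ?thesis ..
    qed
    have "filterlim (\<lambda>t. 1 / (real (N 0) + 1) * (- 1 + t)) at_top at_top"
      by (intro filterlim_tendsto_pos_mult_at_top[OF tendsto_const]
            filterlim_tendsto_add_at_top[OF tendsto_const] filterlim_ident) simp
    then show "filterlim (hinge_term N 0) at_top at_top"
      by (rule filterlim_at_top_mono)
        (auto simp: hinge_term_def intro!: always_eventually divide_right_mono)
  qed (rule summable_hinge_term)
  then show ?thesis
    by (simp add: hinge_gain_def[abs_def])
qed

text \<open>
  One function \<open>hinge_gain N\<close> works for every bounded sequence \<open>b\<close> that falls below \<open>1 / (k + 1)\<close>
  by time \<open>N k\<close> for all but finitely many \<open>k\<close>; for \<open>b n = \<beta> s n\<close> the exceptions are among \<open>k < s\<close>.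
\<close>

lemma summable_hinge_gain:
  fixes b :: "nat \<Rightarrow> real"
  assumes nonneg: "\<And>n. 0 \<le> b n" and bound: "\<And>n. b n \<le> B"
    and small: "\<And>k n. k \<ge> M \<Longrightarrow> n \<ge> N k \<Longrightarrow> b n \<le> 1 / (real k + 1)"
  shows "summable (\<lambda>n. hinge_gain N (b n))"
proof -
  have B: "0 \<le> B"
    using nonneg[of 0] bound[of 0] by linarith
  \<comment> \<open>From time \<open>N M\<close> on, every hinge with \<open>k \<le> M\<close> is zero; for \<open>k < M\<close> the weight is unrelated to \<open>b\<close>.\<close>
  have *: "(\<Sum>n<m. hinge_term N k (b (n + N M))) \<le> (1/2) ^ k * B" for k m
  proof (cases "k \<le> M")
    case True
    have "hinge_term N k (b (n + N M)) = 0" for n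
    proof (rule hinge_term_eq_0)
      have "b (n + N M) \<le> 1 / (real M + 1)"
        by (rule small) auto
      also have "\<dots> \<le> 1 / (real k + 1)"
        using True by (intro divide_left_mono) auto
      finally show "b (n + N M) \<le> 1 / (real k + 1)" .
    qed
    then show ?thesis using B by simp
  next
    case False
    let ?c = "(1/2) ^ k / (real (N k) + 1) * B"
    have "(\<Sum>n<m. hinge_term N k (b (n + N M)))
        = (\<Sum>n\<in>{..<m} \<inter> {..<N k}. hinge_term N k (b (n + N M)))"
      using False by (intro sum.mono_neutral_right) (auto intro!: hinge_term_eq_0 small)
    also have "\<dots> \<le> (\<Sum>n\<in>{..<m} \<inter> {..<N k}. ?c)"
      by (intro sum_mono order_trans[OF hinge_term_le] mult_left_mono nonneg bound) auto
    also have "\<dots> \<le> (\<Sum>n<N k. ?c)"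
      using B by (intro sum_mono2) auto
    also have "\<dots> = real (N k) / (real (N k) + 1) * ((1/2) ^ k * B)"
      by simp
    also have "\<dots> \<le> 1 * ((1/2) ^ k * B)"
      using B by (intro mult_right_mono) auto
    finally show ?thesis by simp
  qed
  have "summable (\<lambda>n. hinge_gain N (b (n + N M)))"
  proof (rule bounded_imp_summable)
    show "0 \<le> hinge_gain N (b (n + N M))" for n
      by (rule class_K_infD(1)[OF hinge_gain_class_K_inf nonneg])
    fix m
    have "(\<Sum>n\<le>m. hinge_gain N (b (n + N M)))
        = (\<Sum>k. \<Sum>n<Suc m. hinge_term N k (b (n + N M)))"
      unfolding hinge_gain_def lessThan_Suc_atMost
      by (rule suminf_sum[symmetric]) (intro summable_hinge_term nonneg)
    also have "\<dots> \<le> (\<Sum>k. (1/2) ^ k * B)"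
      by (intro suminf_le * summable_sum summable_hinge_term nonneg summable_mult2
            summable_geometric) simp
    finally show "(\<Sum>n\<le>m. hinge_gain N (b (n + N M))) \<le> (\<Sum>k. (1/2) ^ k * B)" .
  qed
  then show ?thesis
    using summable_iff_shift[of "\<lambda>n. hinge_gain N (b n)" "N M"] by simp
qed

lemma class_KL_D:
  assumes "\<beta> \<in> class_KL" and "t \<ge> 0"
  shows "(\<lambda>s. \<beta> s t) \<in> class_K_inf"
    and "\<And>s. s > 0 \<Longrightarrow> (\<beta> s \<longlongrightarrow> 0) at_top"
    and "\<And>s. s \<ge> 0 \<Longrightarrow> \<beta> s t \<ge> 0"
    and "\<And>s s'. 0 \<le> s \<Longrightarrow> s \<le> s' \<Longrightarrow> \<beta> s t \<le> \<beta> s' t"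
    and "\<And>s. s \<ge> 0 \<Longrightarrow> \<beta> s t \<le> \<beta> s 0"
proof -
  have K: "(\<lambda>s. \<beta> s t) \<in> class_K_inf" if "t \<ge> 0" for t
    using assms that unfolding class_KL_def by blast
  show "(\<lambda>s. \<beta> s t) \<in> class_K_inf"
    by (rule K[OF \<open>t \<ge> 0\<close>])
  show "(\<beta> s \<longlongrightarrow> 0) at_top" if "s > 0" for s
    using assms that unfolding class_KL_def by blast
  show "\<beta> s t \<ge> 0" if "s \<ge> 0" for s
    using class_K_infD(1)[OF K[OF \<open>t \<ge> 0\<close>]] that by simp
  show "\<beta> s t \<le> \<beta> s' t" if "0 \<le> s" "s \<le> s'" for s s'
    using mono_onD[OF class_K_infD(6)[OF K[OF \<open>t \<ge> 0\<close>]]] that by simp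
  show "\<beta> s t \<le> \<beta> s 0" if "s \<ge> 0" for s
  proof (cases "s = 0 \<or> t = 0")
    case True
    then show ?thesis
      using class_K_infD(4)[OF K[of 0]] class_K_infD(4)[OF K[OF \<open>t \<ge> 0\<close>]] by auto
  next
    case False
    then have "strict_antimono_on {0..} (\<beta> s)"
      using assms that unfolding class_KL_def by auto
    then have "\<beta> s t < \<beta> s 0"
      using False \<open>t \<ge> 0\<close> by (auto simp: monotone_on_def)
    then show ?thesis by simp
  qed
qed

text \<open>
  This takes the place of the factorisation \<open>\<beta> s n \<le> \<gamma>\<^sub>2 (\<theta> ^ n * \<gamma>\<^sub>1 s)\<close> of Sontag's lemma.
\<close>

lemma class_KL_summable_gain:
  assumes KL: "\<beta> \<in> class_KL"
  obtains q where "q \<in> class_K_inf" and "\<And>s. s \<ge> 0 \<Longrightarrow> summable (\<lambda>n. q (\<beta> s (real n)))"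
    and "(\<lambda>s. \<Sum>n. q (\<beta> s (real n))) \<in> class_K_inf"
proof -
  have "\<exists>N. \<forall>n\<ge>N. \<beta> (real k) (real n) < 1 / (real k + 1)" for k
  proof (cases "k = 0")
    case True
    then show ?thesis
      using class_K_infD(4)[OF class_KL_D(1)[OF KL]] by simp
  next
    case False
    then have "(\<lambda>n. \<beta> (real k) (real n)) \<longlonglongrightarrow> 0"
      by (intro filterlim_compose[OF class_KL_D(2)[OF KL] filterlim_real_sequentially]) auto
    then have "\<forall>\<^sub>F n in sequentially. \<beta> (real k) (real n) < 1 / (real k + 1)"
      by (rule order_tendstoD) simp
    then show ?thesis
      by (simp add: eventually_sequentially)
  qed
  then obtain N where N: "\<And>k n. n \<ge> N k \<Longrightarrow> \<beta> (real k) (real n) < 1 / (real k + 1)"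
    by metis
  define q where "q = hinge_gain N"
  have q: "q \<in> class_K_inf"
    unfolding q_def by (rule hinge_gain_class_K_inf)
  have sums: "summable (\<lambda>n. q (\<beta> s (real n)))" if "s \<ge> 0" for s
    unfolding q_def
  proof (rule summable_hinge_gain)
    show "0 \<le> \<beta> s (real n)" and "\<beta> s (real n) \<le> \<beta> s 0" for n
      using class_KL_D[OF KL] that by simp_all
    fix k n assume "k \<ge> nat \<lceil>s\<rceil>" and "n \<ge> N k"
    then have "\<beta> s (real n) \<le> \<beta> (real k) (real n)"
      using that by (intro class_KL_D(4)[OF KL]) linarith+
    then show "\<beta> s (real n) \<le> 1 / (real k + 1)"
      using N[OF \<open>n \<ge> N k\<close>] by simp
  qed
  have "(\<lambda>s. \<Sum>n. q (\<beta> s (real n))) \<in> class_K_inf"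
  proof (rule class_K_inf_suminf)
    fix n :: nat
    note \<beta> = class_KL_D[OF KL of_nat_0_le_iff[of n]]
    show "continuous_on {0..} (\<lambda>s. q (\<beta> s (real n)))"
      using \<beta>(3) by (intro continuous_on_compose2[OF class_K_infD(2)[OF q]
            class_K_infD(2)[OF \<beta>(1)]]) auto
    show "mono_on {0..} (\<lambda>s. q (\<beta> s (real n)))"
      using \<beta>(3,4) by (intro mono_onI mono_onD[OF class_K_infD(6)[OF q]]) auto
    show "q (\<beta> 0 (real n)) = 0"
      using class_K_infD(4)[OF q] class_K_infD(4)[OF \<beta>(1)] by simp
  next
    note \<beta> = class_KL_D[OF KL order_refl]
    show "\<exists>k. q (\<beta> s (real k)) < q (\<beta> t (real k))" if "0 \<le> s" "s < t" for s t
    proof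
      show "q (\<beta> s (real 0)) < q (\<beta> t (real 0))"
        using that \<beta>(3) strict_mono_onD[OF class_K_infD(3)[OF \<beta>(1)]]
        by (intro strict_mono_onD[OF class_K_infD(3)[OF q]]) auto
    qed
    show "filterlim (\<lambda>s. q (\<beta> s (real 0))) at_top at_top"
      using filterlim_compose[OF class_K_infD(5)[OF q] class_K_infD(5)[OF \<beta>(1)]] by simp
  qed (rule sums)
  then show ?thesis
    using that q sums by blast
qed

section \<open>Total cost bounds\<close>

lemma total_cost_le:
  assumes "\<And>x u. 0 \<le> l x u" and "\<And>N. (\<Sum>n<N. l (trajectory f n x u) (u n)) \<le> C"
  shows "total_cost f l x u \<le> ennreal C"
  unfolding total_cost_def
proof (rule suminf_le_const[OF summableI])
  fix N
  show "(\<Sum>n<N. ennreal (l (trajectory f n x u) (u n))) \<le> ennreal C"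
    using assms by (simp add: sum_ennreal ennreal_leI)
qed

text \<open>
  State and input costs are bounded separately; \<open>b (\<sigma> x)\<close> is a majorant of the state cost along a
  controlled trajectory from \<open>x\<close> which depends on \<open>x\<close> only through \<open>\<sigma> x\<close>.
\<close>

lemma uniformly_cost_controllableI:
  assumes \<sigma>: "\<forall>x. 0 \<le> \<sigma> x" and \<rho>: "\<forall>v. 0 \<le> \<rho> v"
    and q: "\<And>s. s \<ge> 0 \<Longrightarrow> 0 \<le> q s" and r: "\<And>s. s \<ge> 0 \<Longrightarrow> 0 \<le> r s"
    and A: "A \<in> class_K_inf" and G: "G \<in> class_K_inf"
    and b: "\<And>s N. s \<ge> 0 \<Longrightarrow> (\<Sum>n<N. b s n) \<le> A s"
    and ctrl: "\<forall>x\<in>S. \<exists>u. (\<forall>n. q (\<sigma> (trajectory f n x u)) \<le> b (\<sigma> x) n) \<and>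
           (\<forall>N\<ge>1. (\<Sum>n<N. r (\<rho> (u n))) \<le> G (\<sigma> x))"
  shows "uniformly_cost_controllable f \<sigma> S (\<lambda>x v. q (\<sigma> x) + r (\<rho> v)) (\<lambda>s. A s + G s)"
  unfolding uniformly_cost_controllable_def
proof (intro conjI ballI)
  show nonneg: "\<forall>x v. 0 \<le> q (\<sigma> x) + r (\<rho> v)"
    using \<sigma> \<rho> q r by (simp add: add_nonneg_nonneg)
  show "(\<lambda>s. A s + G s) \<in> class_K_inf"
    by (rule class_K_inf_add[OF A G])
  fix x assume "x \<in> S"
  then obtain u where u: "\<And>n. q (\<sigma> (trajectory f n x u)) \<le> b (\<sigma> x) n"
    "\<And>N. N \<ge> 1 \<Longrightarrow> (\<Sum>n<N. r (\<rho> (u n))) \<le> G (\<sigma> x)"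
    using ctrl by blast
  have "total_cost f (\<lambda>x v. q (\<sigma> x) + r (\<rho> v)) x u \<le> ennreal (A (\<sigma> x) + G (\<sigma> x))"
  proof (rule total_cost_le)
    fix N
    have "(\<Sum>n<N. q (\<sigma> (trajectory f n x u))) \<le> (\<Sum>n<N. b (\<sigma> x) n)"
      by (intro sum_mono u(1))
    also have "\<dots> \<le> A (\<sigma> x)"
      using b \<sigma> by simp
    finally have "(\<Sum>n<N. q (\<sigma> (trajectory f n x u))) \<le> A (\<sigma> x)" .
    moreover have "(\<Sum>n<N. r (\<rho> (u n))) \<le> G (\<sigma> x)"
      using u(2)[of N] class_K_infD(1)[OF G] \<sigma> by (cases "N = 0") auto
    ultimately show "(\<Sum>n<N. q (\<sigma> (trajectory f n x u)) + r (\<rho> (u n))) \<le> A (\<sigma> x) + G (\<sigma> x)"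
      by (simp add: sum.distrib)
  qed (use nonneg in auto)
  then show "\<exists>u. total_cost f (\<lambda>x v. q (\<sigma> x) + r (\<rho> v)) x u \<le> ennreal (A (\<sigma> x) + G (\<sigma> x))"
    by (intro exI)
qed

theorem theorem1:
  fixes f :: "'x \<Rightarrow> 'u \<Rightarrow> 'x"
    and \<sigma> :: "'x \<Rightarrow> real"
    and \<rho> :: "'u \<Rightarrow> real"
    and S :: "'x set"
    and \<beta> :: "real \<Rightarrow> real \<Rightarrow> real"
    and \<eta> \<gamma> :: "real \<Rightarrow> real"
  assumes "\<forall>x. 0 \<le> \<sigma> x"
    and "\<forall>v. 0 \<le> \<rho> v"
    and "\<beta> \<in> class_KL"
    and "\<eta> \<in> {0..} \<rightarrow> {0..}"
    and "\<gamma> \<in> class_K_inf"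
    and "\<forall>x\<in>S. \<exists>u :: nat \<Rightarrow> 'u.
           (\<forall>n. \<sigma> (trajectory f n x u) \<le> \<beta> (\<sigma> x) (real n)) \<and>
           (\<forall>N\<ge>1. (\<Sum>n<N. \<eta> (\<rho> (u n))) \<le> \<gamma> (\<sigma> x))"
  shows "(\<exists>q\<in>class_K_inf. \<exists>r\<in>{0..} \<rightarrow> {0..}. \<exists>\<alpha>\<in>class_K_inf.
            uniformly_cost_controllable f \<sigma> S (\<lambda>x v. q (\<sigma> x) + r (\<rho> v)) \<alpha>) \<and>
         (pos_def \<eta> \<longrightarrow>
           (\<exists>q\<in>class_K_inf. \<exists>r\<in>{0..} \<rightarrow> {0..}. \<exists>\<alpha>\<in>class_K_inf. pos_def r \<and>
              uniformly_cost_controllable f \<sigma> S (\<lambda>x v. q (\<sigma> x) + r (\<rho> v)) \<alpha>)) \<and>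
         (\<eta> \<in> class_K_inf \<longrightarrow>
           (\<exists>q\<in>class_K_inf. \<exists>r\<in>class_K_inf. \<exists>\<alpha>\<in>class_K_inf.
              uniformly_cost_controllable f \<sigma> S (\<lambda>x v. q (\<sigma> x) + r (\<rho> v)) \<alpha>)) \<and>
         (\<forall>\<theta>\<in>{0<..<1}. \<forall>\<gamma>\<^sub>1\<in>class_K_inf. \<forall>\<gamma>\<^sub>2\<in>class_K_inf.
           (\<forall>s\<ge>0. \<forall>n :: nat. \<beta> s (real n) \<le> \<gamma>\<^sub>2 (\<theta> ^ n * \<gamma>\<^sub>1 s)) \<longrightarrow>
           (\<forall>q\<in>class_K_inf. \<forall>C\<^sub>q>0. (\<forall>s\<ge>0. q s \<le> C\<^sub>q * inv_into {0..} \<gamma>\<^sub>2 s) \<longrightarrow>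
             (\<forall>r\<in>{0..} \<rightarrow> {0..}. \<forall>C\<^sub>r>0. (\<forall>s\<ge>0. r s \<le> C\<^sub>r * \<eta> s) \<longrightarrow>
               uniformly_cost_controllable f \<sigma> S (\<lambda>x v. q (\<sigma> x) + r (\<rho> v))
                 (\<lambda>s. C\<^sub>q / (1 - \<theta>) * \<gamma>\<^sub>1 s + C\<^sub>r * \<gamma> s))))"
proof -
  note \<sigma> = assms(1) and \<rho> = assms(2) and KL = assms(3) and \<eta> = assms(4) and \<gamma> = assms(5)
    and ctrl = assms(6)
  have ex: "\<exists>q\<in>class_K_inf. \<exists>\<alpha>\<in>class_K_inf.
      uniformly_cost_controllable f \<sigma> S (\<lambda>x v. q (\<sigma> x) + \<eta> (\<rho> v)) \<alpha>"
  proof -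
    obtain q where q: "q \<in> class_K_inf"
      and sums: "\<And>s. s \<ge> 0 \<Longrightarrow> summable (\<lambda>n. q (\<beta> s (real n)))"
      and A: "(\<lambda>s. \<Sum>n. q (\<beta> s (real n))) \<in> class_K_inf"
      using class_KL_summable_gain[OF KL] by blast
    have "uniformly_cost_controllable f \<sigma> S (\<lambda>x v. q (\<sigma> x) + \<eta> (\<rho> v))
        (\<lambda>s. (\<Sum>n. q (\<beta> s (real n))) + \<gamma> s)"
    proof (rule uniformly_cost_controllableI[OF \<sigma> \<rho> _ _ A \<gamma>])
      show "(\<Sum>n<N. q (\<beta> s (real n))) \<le> (\<Sum>n. q (\<beta> s (real n)))" if "s \<ge> 0" for s N
        by (intro sum_le_suminf sums that)
          (auto intro!: class_K_infD(1)[OF q] class_KL_D(3)[OF KL] that)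
      have q_mono: "q (\<sigma> y) \<le> q t" if "\<sigma> y \<le> t" for y t
        using \<sigma> that order_trans[of 0 "\<sigma> y" t]
        by (intro mono_onD[OF class_K_infD(6)[OF q]]) auto
      show "\<forall>x\<in>S. \<exists>u. (\<forall>n. q (\<sigma> (trajectory f n x u)) \<le> q (\<beta> (\<sigma> x) (real n))) \<and>
           (\<forall>N\<ge>1. (\<Sum>n<N. \<eta> (\<rho> (u n))) \<le> \<gamma> (\<sigma> x))"
        using ctrl q_mono by meson
    qed (use class_K_infD(1)[OF q] \<eta> in auto)
    then show ?thesis
      using q class_K_inf_add[OF A \<gamma>] by blast
  qed
  have explicit: "uniformly_cost_controllable f \<sigma> S (\<lambda>x v. q (\<sigma> x) + r (\<rho> v))
      (\<lambda>s. C\<^sub>q / (1 - \<theta>) * \<gamma>\<^sub>1 s + C\<^sub>r * \<gamma> s)"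
    if \<theta>: "\<theta> \<in> {0<..<1}" and \<gamma>\<^sub>1: "\<gamma>\<^sub>1 \<in> class_K_inf" and \<gamma>\<^sub>2: "\<gamma>\<^sub>2 \<in> class_K_inf"
      and \<beta>_le: "\<forall>s\<ge>0. \<forall>n :: nat. \<beta> s (real n) \<le> \<gamma>\<^sub>2 (\<theta> ^ n * \<gamma>\<^sub>1 s)"
      and q: "q \<in> class_K_inf" and C\<^sub>q: "C\<^sub>q > 0"
      and q_le: "\<forall>s\<ge>0. q s \<le> C\<^sub>q * inv_into {0..} \<gamma>\<^sub>2 s"
      and r: "r \<in> {0..} \<rightarrow> {0..}" and C\<^sub>r: "C\<^sub>r > 0" and r_le: "\<forall>s\<ge>0. r s \<le> C\<^sub>r * \<eta> s"
    for \<theta> C\<^sub>q C\<^sub>r :: real and \<gamma>\<^sub>1 \<gamma>\<^sub>2 q r :: "real \<Rightarrow> real"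
  proof (rule uniformly_cost_controllableI[OF \<sigma> \<rho>])
    show "(\<lambda>s. C\<^sub>q / (1 - \<theta>) * \<gamma>\<^sub>1 s) \<in> class_K_inf"
      using \<theta> C\<^sub>q by (intro class_K_inf_cmult \<gamma>\<^sub>1) auto
    show "(\<lambda>s. C\<^sub>r * \<gamma> s) \<in> class_K_inf"
      by (intro class_K_inf_cmult \<gamma> C\<^sub>r)
    show "(\<Sum>n<N. C\<^sub>q * (\<theta> ^ n * \<gamma>\<^sub>1 s)) \<le> C\<^sub>q / (1 - \<theta>) * \<gamma>\<^sub>1 s" if "s \<ge> 0" for s N
    proof -
      have "(\<Sum>n<N. \<theta> ^ n) \<le> (\<Sum>n. \<theta> ^ n)"
        using \<theta> by (intro sum_le_suminf summable_geometric) auto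
      also have "\<dots> = 1 / (1 - \<theta>)"
        using \<theta> by (intro suminf_geometric) auto
      finally have "C\<^sub>q * \<gamma>\<^sub>1 s * (\<Sum>n<N. \<theta> ^ n) \<le> C\<^sub>q * \<gamma>\<^sub>1 s * (1 / (1 - \<theta>))"
        using C\<^sub>q class_K_infD(1)[OF \<gamma>\<^sub>1 that] by (intro mult_left_mono) auto
      then show ?thesis
        by (simp add: sum_distrib_left mult_ac)
    qed
    show "\<forall>x\<in>S. \<exists>u. (\<forall>n. q (\<sigma> (trajectory f n x u)) \<le> C\<^sub>q * (\<theta> ^ n * \<gamma>\<^sub>1 (\<sigma> x))) \<and>
           (\<forall>N\<ge>1. (\<Sum>n<N. r (\<rho> (u n))) \<le> C\<^sub>r * \<gamma> (\<sigma> x))"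
    proof
      fix x assume "x \<in> S"
      then obtain u where u: "\<And>n. \<sigma> (trajectory f n x u) \<le> \<beta> (\<sigma> x) (real n)"
        "\<And>N. N \<ge> 1 \<Longrightarrow> (\<Sum>n<N. \<eta> (\<rho> (u n))) \<le> \<gamma> (\<sigma> x)"
        using ctrl by blast
      have "q (\<sigma> (trajectory f n x u)) \<le> C\<^sub>q * (\<theta> ^ n * \<gamma>\<^sub>1 (\<sigma> x))" for n
      proof -
        have "\<sigma> (trajectory f n x u) \<le> \<gamma>\<^sub>2 (\<theta> ^ n * \<gamma>\<^sub>1 (\<sigma> x))"
          using u(1)[of n] \<beta>_le \<sigma> by (meson order_trans)
        then have "inv_into {0..} \<gamma>\<^sub>2 (\<sigma> (trajectory f n x u)) \<le> \<theta> ^ n * \<gamma>\<^sub>1 (\<sigma> x)"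
          using \<theta> \<sigma> class_K_infD(1)[OF \<gamma>\<^sub>1] by (intro class_K_inf_inv_le[OF \<gamma>\<^sub>2]) auto
        then have "C\<^sub>q * inv_into {0..} \<gamma>\<^sub>2 (\<sigma> (trajectory f n x u)) \<le> C\<^sub>q * (\<theta> ^ n * \<gamma>\<^sub>1 (\<sigma> x))"
          using C\<^sub>q by simp
        then show ?thesis
          using q_le \<sigma> by (meson order_trans)
      qed
      moreover have "(\<Sum>n<N. r (\<rho> (u n))) \<le> C\<^sub>r * \<gamma> (\<sigma> x)" if "N \<ge> 1" for N
      proof -
        have "(\<Sum>n<N. r (\<rho> (u n))) \<le> C\<^sub>r * (\<Sum>n<N. \<eta> (\<rho> (u n)))"
          unfolding sum_distrib_left using r_le \<rho> by (intro sum_mono) simp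
        also have "\<dots> \<le> C\<^sub>r * \<gamma> (\<sigma> x)"
          using u(2)[OF that] C\<^sub>r by simp
        finally show ?thesis .
      qed
      ultimately show "\<exists>u. (\<forall>n. q (\<sigma> (trajectory f n x u)) \<le> C\<^sub>q * (\<theta> ^ n * \<gamma>\<^sub>1 (\<sigma> x))) \<and>
           (\<forall>N\<ge>1. (\<Sum>n<N. r (\<rho> (u n))) \<le> C\<^sub>r * \<gamma> (\<sigma> x))"
        by blast
    qed
  qed (use class_K_infD(1)[OF q] r in auto)
  show ?thesis
  proof (intro conjI impI)
    show "\<exists>q\<in>class_K_inf. \<exists>r\<in>{0..} \<rightarrow> {0..}. \<exists>\<alpha>\<in>class_K_inf.
        uniformly_cost_controllable f \<sigma> S (\<lambda>x v. q (\<sigma> x) + r (\<rho> v)) \<alpha>"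
      using ex \<eta> by blast
    show "\<exists>q\<in>class_K_inf. \<exists>r\<in>{0..} \<rightarrow> {0..}. \<exists>\<alpha>\<in>class_K_inf. pos_def r \<and>
        uniformly_cost_controllable f \<sigma> S (\<lambda>x v. q (\<sigma> x) + r (\<rho> v)) \<alpha>" if "pos_def \<eta>"
      using ex \<eta> that by blast
    show "\<exists>q\<in>class_K_inf. \<exists>r\<in>class_K_inf. \<exists>\<alpha>\<in>class_K_inf.
        uniformly_cost_controllable f \<sigma> S (\<lambda>x v. q (\<sigma> x) + r (\<rho> v)) \<alpha>" if "\<eta> \<in> class_K_inf"
      using ex that by blast
  qed (intro ballI allI impI; rule explicit; assumption)
qed

end
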